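(* In the setting described in the context (absorbing chain with spectral duality $B_\nu(z)=\kappa(z)A_\nu(\sigma(z))$, $\kappa(z)\kappa(\sigma(z))=K$, and twisted boundary pairing), let $C^*=1/(1+\sqrt K)$ and let $\psi(\gamma)=u(\gamma)-C^*s(\gamma)=R(\gamma)(b^{(0)}-C^*b)$ be the orientation field. Then for every reset distribution $\pi$ and every $\gamma\in(0,1)$, $$\operatorname{sgn}\bigl(C(\pi,\gamma)-C^*\bigr)=\operatorname{sgn}\,\langle\pi,\psi(\gamma)\rangle.$$
   Context: Setting. A Markov chain lives on a finite set $\mathcal{T}\cup\partial_0\cup\partial_1$ (disjoint union); $\mathcal{T}$ consists of transient states, $\partial_0\cup\partial_1$ is the absorbing boundary, the restriction of the chain to $\mathcal{T}$ is irreducible, and absorption is certain from every state of $\mathcal{T}$. $P=(P_{z,w})_{z,w\in\mathcal{T}}$ is the restricted transition matrix (spectral radius $<1$), and $R(\gamma)=(I-(1-\gamma)P)^{-1}$ for $\gamma\in(0,1)$. The boundary fluxes are $b^{(0)}_x=\sum_{y\in\partial_0}P_{xy}$, $b^{(1)}_x=\sum_{y\in\partial_1}P_{xy}$, $b=b^{(0)}+b^{(1)}$. The first-passage vectors are $u(\gamma)=R(\gamma)b^{(0)}$ and $s(\gamma)=R(\gamma)b$. $P$ is diagonalizable with biorthogonal right/left eigenvectors $\varphi_\nu,\psi_\nu$ ($\psi_\nu^{\mathsf T}\varphi_\mu=\delta_{\nu\mu}$), and $A_\nu(z)=\varphi_\nu(z)(\psi_\nu^{\mathsf T}b^{(0)})$,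 $B_\nu(z)=\varphi_\nu(z)(\psi_\nu^{\mathsf T}b^{(1)})$. Standing assumptions: $\sigma:\mathcal{T}\to\mathcal{T}$ is an involution and $\kappa:\mathcal{T}\to(0,\infty)$ satisfies $B_\nu(z)=\kappa(z)A_\nu(\sigma(z))$ for all $\nu,z$; $\kappa(z)\kappa(\sigma(z))=K$ for all $z$; and $b^{(1)}_z=\kappa(z)b^{(0)}_{\sigma(z)}$ for all $z$. A reset distribution is a probability vector $\pi$ supported on a set of reset sites $\{z_1,\dots,z_m\}\subset\mathcal{T}$, regarded as a vector on $\mathcal{T}$. $\langle\pi,v\rangle=\sum_z\pi_zv_z$, and the coupling functional is $C(\pi,\gamma)=\langle\pi,u(\gamma)\rangle/\langle\pi,s(\gamma)\rangle$. (The vector $\psi(\gamma)$ is not to be confused with the left eigenvectors $\psi_\nu$.) $\operatorname{sgn}$ takes values in $\{-1,0,1\}$. *)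

theory Defs
  imports "HOL-Probability.Probability"
begin

text \<open>
  The state space is the disjoint union of the transient states \<open>'t\<close> and the two boundary
  components \<open>'a\<close> and \<open>'b\<close>. Finiteness is imposed by the sort constraints. That types are
  nonempty is no restriction: an empty boundary component would force, through the boundary
  pairing, both fluxes to vanish, contradicting certain absorption.
\<close>

type_synonym ('t, 'a, 'b) state = "'t + ('a + 'b)"

type_synonym ('t, 'a, 'b) chain = "('t, 'a, 'b) state \<Rightarrow> ('t, 'a, 'b) state pmf"

definition transient_matrix :: "('t::finite, 'a, 'b) chain \<Rightarrow> real ^ 't ^ 't" where
  "transient_matrix Q = (\<chi> x y. pmf (Q (Inl x)) (Inl y))"

definition flux0 :: "('t::finite, 'a::finite, 'b) chain \<Rightarrow> real ^ 't" where
  "flux0 Q = (\<chi> x. \<Sum>y\<in>UNIV. pmf (Q (Inl x)) (Inr (Inl y)))"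

definition flux1 :: "('t::finite, 'a, 'b::finite) chain \<Rightarrow> real ^ 't" where
  "flux1 Q = (\<chi> x. \<Sum>y\<in>UNIV. pmf (Q (Inl x)) (Inr (Inr y)))"

definition flux :: "('t::finite, 'a::finite, 'b::finite) chain \<Rightarrow> real ^ 't" where
  "flux Q = flux0 Q + flux1 Q"

definition absorbing_boundary :: "('t, 'a, 'b) chain \<Rightarrow> bool" where
  "absorbing_boundary Q \<longleftrightarrow> (\<forall>y. Q (Inr y) = return_pmf (Inr y))"

definition irreducible_matrix :: "real ^ 't ^ 't \<Rightarrow> bool" where
  "irreducible_matrix P \<longleftrightarrow> (\<forall>x y. \<exists>n. (((**) P ^^ n) (mat 1)) $ x $ y > 0)"

text \<open>The law of the chain at time \<open>n\<close> when started in \<open>x\<close>.\<close>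

definition law_at :: "('t, 'a, 'b) chain \<Rightarrow> nat \<Rightarrow> ('t, 'a, 'b) state \<Rightarrow> ('t, 'a, 'b) state pmf" where
  "law_at Q n x = ((\<lambda>p. bind_pmf p Q) ^^ n) (return_pmf x)"

text \<open>
  For an absorbing boundary the events \<open>X\<^sub>n \<in> \<partial>\<^sub>0 \<union> \<partial>\<^sub>1\<close> increase with \<open>n\<close>, so the limit of
  their probabilities is the probability of ever being absorbed.
\<close>

definition certain_absorption :: "('t, 'a, 'b) chain \<Rightarrow> bool" where
  "certain_absorption Q \<longleftrightarrow>
     (\<forall>x. (\<lambda>n. measure_pmf.prob (law_at Q n (Inl x)) (range Inr)) \<longlonglongrightarrow> 1)"

definition resolvent :: "('t::finite, 'a, 'b) chain \<Rightarrow> real \<Rightarrow> real ^ 't ^ 't" where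
  "resolvent Q \<gamma> = matrix_inv (mat 1 - (1 - \<gamma>) *\<^sub>R transient_matrix Q)"

definition u_vec :: "('t::finite, 'a::finite, 'b) chain \<Rightarrow> real \<Rightarrow> real ^ 't" where
  "u_vec Q \<gamma> = resolvent Q \<gamma> *v flux0 Q"

definition s_vec :: "('t::finite, 'a::finite, 'b::finite) chain \<Rightarrow> real \<Rightarrow> real ^ 't" where
  "s_vec Q \<gamma> = resolvent Q \<gamma> *v flux Q"

text \<open>
  Eigenvalues and eigenvectors of the real matrix \<open>P\<close> may be complex. The pairing is the
  bilinear one, without conjugation.
\<close>

definition cvec :: "real ^ 't \<Rightarrow> complex ^ 't" where
  "cvec v = (\<chi> i. complex_of_real (v $ i))"

definition cmat :: "real ^ 't ^ 's \<Rightarrow> complex ^ 't ^ 's" where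
  "cmat = map_matrix complex_of_real"

definition pairing :: "complex ^ 't::finite \<Rightarrow> complex ^ 't \<Rightarrow> complex" where
  "pairing v w = (\<Sum>i\<in>UNIV. v $ i * w $ i)"

text \<open>
  Biorthogonality makes the \<open>\<phi> \<nu>\<close> linearly independent, so the cardinality condition makes
  them an eigenbasis; existence of such a system is diagonalizability of \<open>M\<close>.
\<close>

definition biorthogonal_eigensystem ::
  "complex ^ 't ^ 't \<Rightarrow> ('n::finite \<Rightarrow> complex) \<Rightarrow>
     ('n \<Rightarrow> complex ^ 't::finite) \<Rightarrow> ('n \<Rightarrow> complex ^ 't) \<Rightarrow> bool" where
  "biorthogonal_eigensystem M \<theta> \<phi> \<psi> \<longleftrightarrow>
     CARD('n) = CARD('t) \<and>
     (\<forall>\<nu>. M *v \<phi> \<nu> = \<theta> \<nu> *s \<phi> \<nu>) \<and>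
     (\<forall>\<nu>. \<psi> \<nu> v* M = \<theta> \<nu> *s \<psi> \<nu>) \<and>
     (\<forall>\<nu> \<mu>. pairing (\<psi> \<nu>) (\<phi> \<mu>) = (if \<nu> = \<mu> then 1 else 0))"

definition A_coeff :: "('t::finite, 'a::finite, 'b) chain \<Rightarrow> ('n \<Rightarrow> complex ^ 't) \<Rightarrow>
    ('n \<Rightarrow> complex ^ 't) \<Rightarrow> 'n \<Rightarrow> 't \<Rightarrow> complex" where
  "A_coeff Q \<phi> \<psi> \<nu> z = \<phi> \<nu> $ z * pairing (\<psi> \<nu>) (cvec (flux0 Q))"

definition B_coeff :: "('t::finite, 'a, 'b::finite) chain \<Rightarrow> ('n \<Rightarrow> complex ^ 't) \<Rightarrow>
    ('n \<Rightarrow> complex ^ 't) \<Rightarrow> 'n \<Rightarrow> 't \<Rightarrow> complex" where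
  "B_coeff Q \<phi> \<psi> \<nu> z = \<phi> \<nu> $ z * pairing (\<psi> \<nu>) (cvec (flux1 Q))"

definition reset_distribution :: "'t::finite set \<Rightarrow> real ^ 't \<Rightarrow> bool" where
  "reset_distribution Z p \<longleftrightarrow>
     (\<forall>z. 0 \<le> p $ z) \<and> (\<Sum>z\<in>UNIV. p $ z) = 1 \<and> (\<forall>z. z \<notin> Z \<longrightarrow> p $ z = 0)"

definition coupling ::
  "('t::finite, 'a::finite, 'b::finite) chain \<Rightarrow> real ^ 't \<Rightarrow> real \<Rightarrow> real" where
  "coupling Q p \<gamma> = (p \<bullet> u_vec Q \<gamma>) / (p \<bullet> s_vec Q \<gamma>)"

definition C_star :: "real \<Rightarrow> real" where
  "C_star K = 1 / (1 + sqrt K)"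

definition orientation_field ::
  "('t::finite, 'a::finite, 'b::finite) chain \<Rightarrow> real \<Rightarrow> real \<Rightarrow> real ^ 't" where
  "orientation_field Q K \<gamma> = u_vec Q \<gamma> - C_star K *\<^sub>R s_vec Q \<gamma>"

end

theory Submission imports Defs begin

text \<open>
  The formula for \<open>\<psi>\<close> is linearity of the resolvent. Pairing \<open>\<psi> = u - C\<^sup>* s\<close> with \<open>\<pi>\<close> and
  using \<open>\<langle>\<pi>,u\<rangle> = C \<langle>\<pi>,s\<rangle>\<close>, valid when \<open>\<langle>\<pi>,s\<rangle> \<noteq> 0\<close>, gives
  \<open>\<langle>\<pi>,\<psi>\<rangle> = (C - C\<^sup>*) \<langle>\<pi>,s\<rangle>\<close>. So the two signs agree once \<open>\<langle>\<pi>,s\<rangle> > 0\<close>. This is the substance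
  of the theorem; it holds because \<open>s\<close> is strictly positive at every transient state
  (\<open>s_vec_pos\<close>) and \<open>\<pi>\<close> is a probability vector.

  Positivity rests on a discrete minimum principle (\<open>substochastic_minimum_principle\<close>).
  The vector \<open>s\<close> solves \<open>s = (1 - \<gamma>) P s + b\<close>
  with \<open>P\<close> substochastic and \<open>b \<ge> 0\<close>, so looking at a minimising state shows that \<open>s \<ge> 0\<close>;
  the same principle makes \<open>I - (1 - \<gamma>) P\<close> injective and hence the resolvent a genuine inverse.
  If \<open>s\<close> vanished somewhere, the equation would propagate the zero along every transition
  of positive probability and would force the boundary flux to vanish at each zero. The chain
  could never leave the zero set of \<open>s\<close>, contradicting certain absorption.
\<close>

text \<open>At a minimiser \<open>j\<close> of \<open>x\<close> with \<open>x\<^sub>j < 0\<close>, averaging against a substochastic row cannot go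
  below \<open>x\<^sub>j\<close>, so \<open>x\<^sub>j \<ge> c x\<^sub>j\<close>, which is impossible for \<open>c < 1\<close>.\<close>

lemma substochastic_minimum_principle:
  fixes A :: "real ^ 'n::finite ^ 'n" and x :: "real ^ 'n" and c :: real
  assumes nonneg: "\<And>i j. 0 \<le> A $ i $ j"
    and row: "\<And>i. (\<Sum>j\<in>UNIV. A $ i $ j) \<le> 1"
    and c: "0 \<le> c" "c < 1"
    and super: "\<And>i. c * (A *v x) $ i \<le> x $ i"
  shows "0 \<le> x $ i"
proof (rule ccontr)
  assume "\<not> 0 \<le> x $ i"
  have "Min (range (($) x)) \<in> range (($) x)"
    by (rule Min_in) auto
  then obtain j where "Min (range (($) x)) = x $ j"
    by (rule imageE)
  then have min: "x $ j \<le> x $ k" for k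
    by (metis Min_le finite finite_imageI rangeI)
  have neg: "x $ j < 0"
    using min[of i] \<open>\<not> 0 \<le> x $ i\<close> by linarith
  have "1 * x $ j \<le> (\<Sum>k\<in>UNIV. A $ j $ k) * x $ j"
    using row[of j] neg by (intro mult_right_mono_neg) auto
  also have "\<dots> = (\<Sum>k\<in>UNIV. A $ j $ k * x $ j)"
    by (simp add: sum_distrib_right)
  also have "\<dots> \<le> (\<Sum>k\<in>UNIV. A $ j $ k * x $ k)"
    by (intro sum_mono mult_left_mono min nonneg)
  also have "\<dots> = (A *v x) $ j"
    by (simp add: matrix_vector_mult_def)
  finally have "c * x $ j \<le> c * (A *v x) $ j"
    using c by (simp add: mult_left_mono)
  also have "\<dots> \<le> x $ j"
    by (rule super)
  finally have "(1 - c) * x $ j \<ge> 0"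
    by (simp add: algebra_simps)
  moreover have "(1 - c) * x $ j < 0"
    using c neg by (simp add: mult_pos_neg)
  ultimately show False
    by linarith
qed

lemma invertible_mult_matrix_inv:
  fixes M :: "'a::semiring_1 ^ 'n::finite ^ 'm::finite"
  assumes "invertible M"
  shows "M ** matrix_inv M = mat 1"
  using someI_ex[OF assms[unfolded invertible_def]] by (simp add: matrix_inv_def)

lemma identity_minus_scaled_mult_nth:
  fixes A :: "real ^ 'n::finite ^ 'n"
  shows "((mat 1 - c *\<^sub>R A) *v x) $ i = x $ i - c * (A *v x) $ i"
  by (simp add: matrix_vector_mult_diff_rdistrib scaleR_matrix_vector_assoc[symmetric])

lemma invertible_identity_minus_substochastic:
  fixes A :: "real ^ 'n::finite ^ 'n" and c :: real
  assumes "\<And>i j. 0 \<le> A $ i $ j" and "\<And>i. (\<Sum>j\<in>UNIV. A $ i $ j) \<le> 1"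
    and "0 \<le> c" "c < 1"
  shows "invertible (mat 1 - c *\<^sub>R A)"
proof -
  have "x = 0" if ker: "(mat 1 - c *\<^sub>R A) *v x = 0" for x
  proof -
    have eq: "c * (A *v x) $ i = x $ i" for i
      using identity_minus_scaled_mult_nth[of c A x i] ker by simp
    \<comment> \<open>The minimum principle applies to both a kernel vector and its negative.\<close>
    have "0 \<le> x $ i" for i
      using substochastic_minimum_principle[of A c x] assms eq by simp
    moreover have "0 \<le> (- x) $ i" for i
    proof (rule substochastic_minimum_principle[of A c])
      show "c * (A *v (- x)) $ i \<le> (- x) $ i" for i
        using eq[of i] by (simp add: matrix_vector_mult_def sum_negf)
    qed (use assms in auto)
    ultimately show "x = 0"
      by (simp add: vec_eq_iff order_antisym)
  qed
  then show ?thesis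
    using invertible_left_inverse matrix_left_invertible_ker by blast
qed

lemma transient_matrix_nonneg: "0 \<le> transient_matrix Q $ x $ y"
  by (simp add: transient_matrix_def)

lemma transient_matrix_row_sum:
  "(\<Sum>y\<in>UNIV. transient_matrix Q $ x $ y) \<le> 1"
proof -
  have "(\<Sum>y\<in>UNIV. transient_matrix Q $ x $ y) = sum (pmf (Q (Inl x))) (range Inl)"
    by (simp add: transient_matrix_def sum.reindex)
  also have "\<dots> = measure_pmf.prob (Q (Inl x)) (range Inl)"
    by (simp add: measure_measure_pmf_finite)
  finally show ?thesis
    by simp
qed

lemma flux_nonneg: "0 \<le> flux Q $ x"
  by (simp add: flux_def flux0_def flux1_def sum_nonneg)

lemma flux_eq_0_iff: "flux Q $ x = 0 \<longleftrightarrow> (\<forall>y. Inr y \<notin> set_pmf (Q (Inl x)))"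
  by (auto simp: flux_def flux0_def flux1_def add_nonneg_eq_0_iff sum_nonneg
      sum_nonneg_eq_0_iff set_pmf_iff)
     (metis sum.exhaust)

lemma s_vec_equation:
  assumes "0 < \<gamma>" "\<gamma> \<le> 1"
  shows "s_vec Q \<gamma> $ x = (1 - \<gamma>) * (transient_matrix Q *v s_vec Q \<gamma>) $ x + flux Q $ x"
proof -
  have "invertible (mat 1 - (1 - \<gamma>) *\<^sub>R transient_matrix Q)"
    using assms
    by (intro invertible_identity_minus_substochastic transient_matrix_nonneg transient_matrix_row_sum)
      auto
  then have "(mat 1 - (1 - \<gamma>) *\<^sub>R transient_matrix Q) *v s_vec Q \<gamma> = flux Q"
    by (simp add: s_vec_def resolvent_def matrix_vector_mul_assoc invertible_mult_matrix_inv)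
  then show ?thesis
    using identity_minus_scaled_mult_nth[of "1 - \<gamma>" "transient_matrix Q" "s_vec Q \<gamma>" x] by simp
qed

lemma s_vec_nonneg:
  assumes "0 < \<gamma>" "\<gamma> \<le> 1"
  shows "0 \<le> s_vec Q \<gamma> $ x"
proof (rule substochastic_minimum_principle[of "transient_matrix Q" "1 - \<gamma>"])
  show "(1 - \<gamma>) * (transient_matrix Q *v s_vec Q \<gamma>) $ x \<le> s_vec Q \<gamma> $ x" for x
    using s_vec_equation[OF assms, of Q x] flux_nonneg[of Q x] by simp
qed (use assms in \<open>auto simp: transient_matrix_nonneg transient_matrix_row_sum\<close>)

lemma set_pmf_law_at_closed:
  assumes "x \<in> S" and "\<And>y. y \<in> S \<Longrightarrow> set_pmf (Q y) \<subseteq> S"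
  shows "set_pmf (law_at Q n x) \<subseteq> S"
  using assms by (induction n) (auto simp: law_at_def)

lemma no_closed_transient_set:
  assumes "certain_absorption Q" and "x \<in> S"
    and closed: "\<And>y. y \<in> S \<Longrightarrow> set_pmf (Q (Inl y)) \<subseteq> Inl ` S"
  shows False
proof -
  have "set_pmf (law_at Q n (Inl x)) \<subseteq> Inl ` S" for n
    using assms(2) closed by (intro set_pmf_law_at_closed) auto
  then have "measure_pmf.prob (law_at Q n (Inl x)) (range Inr) = 0" for n
    unfolding measure_pmf_zero_iff by blast
  moreover have "(\<lambda>n. measure_pmf.prob (law_at Q n (Inl x)) (range Inr)) \<longlonglongrightarrow> 1"
    using assms(1) by (simp add: certain_absorption_def)
  ultimately show False
    by (simp add: LIMSEQ_const_iff)
qed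

text \<open>At a zero of \<open>s\<close> both nonnegative terms of the equation \<open>s = (1 - \<gamma>) P s + b\<close> vanish, so the
  zero set of \<open>s\<close> is closed for the chain. The bound \<open>\<gamma> < 1\<close> lets the zero propagate along
  transitions of positive probability.\<close>

lemma s_vec_pos:
  assumes absorb: "certain_absorption Q" and "0 < \<gamma>" "\<gamma> < 1"
  shows "0 < s_vec Q \<gamma> $ x"
proof (rule ccontr)
  define S where "S = {y. s_vec Q \<gamma> $ y = 0}"
  have nonneg: "0 \<le> s_vec Q \<gamma> $ y" for y
    using assms by (intro s_vec_nonneg) auto
  assume "\<not> 0 < s_vec Q \<gamma> $ x"
  then have "x \<in> S"
    using nonneg[of x] by (simp add: S_def)
  then show False
  proof (rule no_closed_transient_set[OF absorb])
    fix y assume "y \<in> S"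
    have terms: "0 \<le> transient_matrix Q $ y $ w * s_vec Q \<gamma> $ w" for w
      by (simp add: nonneg transient_matrix_nonneg)
    then have Ps: "0 \<le> (transient_matrix Q *v s_vec Q \<gamma>) $ y"
      by (simp add: matrix_vector_mult_def sum_nonneg)
    have "(1 - \<gamma>) * (transient_matrix Q *v s_vec Q \<gamma>) $ y + flux Q $ y = 0"
      using s_vec_equation[of \<gamma> Q y] assms \<open>y \<in> S\<close> by (simp add: S_def)
    moreover have "0 \<le> (1 - \<gamma>) * (transient_matrix Q *v s_vec Q \<gamma>) $ y"
      using Ps assms by simp
    ultimately have "(1 - \<gamma>) * (transient_matrix Q *v s_vec Q \<gamma>) $ y = 0"
      and no_exit: "flux Q $ y = 0"
      using flux_nonneg[of Q y] by linarith+
    then have "(\<Sum>w\<in>UNIV. transient_matrix Q $ y $ w * s_vec Q \<gamma> $ w) = 0"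
      using assms by (simp add: matrix_vector_mult_def)
    then have "transient_matrix Q $ y $ w * s_vec Q \<gamma> $ w = 0" for w
      using terms by (simp add: sum_nonneg_eq_0_iff)
    then have inner: "w \<in> S" if "Inl w \<in> set_pmf (Q (Inl y))" for w
      using that by (auto simp: S_def transient_matrix_def set_pmf_iff)
    show "set_pmf (Q (Inl y)) \<subseteq> Inl ` S"
    proof
      fix v assume v: "v \<in> set_pmf (Q (Inl y))"
      show "v \<in> Inl ` S"
        using v inner no_exit by (cases v) (auto simp: flux_eq_0_iff)
    qed
  qed
qed

lemma reset_distribution_inner_pos:
  assumes "reset_distribution Z p" and pos: "\<And>z. 0 < v $ z"
  shows "0 < p \<bullet> v"
proof -
  have nonneg: "0 \<le> p $ z" for z
    using assms(1) by (simp add: reset_distribution_def)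
  obtain z where "p $ z \<noteq> 0"
    using assms(1) by (metis reset_distribution_def sum.neutral zero_neq_one)
  then have "0 < p $ z * v $ z"
    using nonneg[of z] pos by simp
  then have "0 < (\<Sum>i\<in>UNIV. p $ i * v $ i)"
    using nonneg pos by (intro sum_pos2[of UNIV z]) (auto intro: mult_nonneg_nonneg less_imp_le)
  then show ?thesis
    by (simp add: inner_vec_def)
qed

theorem mainTheorem5:
  fixes Q :: "('t::finite, 'a::finite, 'b::finite) chain"
    and \<theta> :: "'n::finite \<Rightarrow> complex"
    and \<phi> \<psi> :: "'n \<Rightarrow> complex ^ 't"
    and \<sigma> :: "'t \<Rightarrow> 't" and \<kappa> :: "'t \<Rightarrow> real" and K :: real
    and Z :: "'t set" and p :: "real ^ 't" and \<gamma> :: real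
  assumes "absorbing_boundary Q"
    and "irreducible_matrix (transient_matrix Q)"
    and "certain_absorption Q"
    and "biorthogonal_eigensystem (cmat (transient_matrix Q)) \<theta> \<phi> \<psi>"
    and "\<forall>z. \<sigma> (\<sigma> z) = z"
    and "\<forall>z. \<kappa> z > 0"
    and "\<forall>\<nu> z. B_coeff Q \<phi> \<psi> \<nu> z = complex_of_real (\<kappa> z) * A_coeff Q \<phi> \<psi> \<nu> (\<sigma> z)"
    and "\<forall>z. \<kappa> z * \<kappa> (\<sigma> z) = K"
    and "\<forall>z. flux1 Q $ z = \<kappa> z * flux0 Q $ \<sigma> z"
    and "reset_distribution Z p"
    and "0 < \<gamma>" and "\<gamma> < 1"
  shows "orientation_field Q K \<gamma> = resolvent Q \<gamma> *v (flux0 Q - C_star K *\<^sub>R flux Q) \<and>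
         sgn (coupling Q p \<gamma> - C_star K) = sgn (p \<bullet> orientation_field Q K \<gamma>)"
proof
  show "orientation_field Q K \<gamma> = resolvent Q \<gamma> *v (flux0 Q - C_star K *\<^sub>R flux Q)"
    by (simp add: orientation_field_def u_vec_def s_vec_def matrix_vector_mult_diff_distrib
        matrix_vector_mult_scaleR)
next
  have pos: "0 < p \<bullet> s_vec Q \<gamma>"
    using assms by (intro reset_distribution_inner_pos[of Z] s_vec_pos) auto
  then have "p \<bullet> orientation_field Q K \<gamma> = (coupling Q p \<gamma> - C_star K) * (p \<bullet> s_vec Q \<gamma>)"
    by (simp add: orientation_field_def coupling_def inner_diff_right left_diff_distrib)
  then show "sgn (coupling Q p \<gamma> - C_star K) = sgn (p \<bullet> orientation_field Q K \<gamma>)"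
    using pos by (simp add: sgn_mult)
qed

end
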